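(* The category $\mathrm{Part}$ of partial groups is universal, i.e. for every group $H$ there exists a partial group $\mathbb{M}$ such that $\operatorname{Aut}_{\mathrm{Part}}(\mathbb{M})\cong H$. Moreover, given an abstract group $H$ there exist infinitely many pairwise non-isomorphic partial groups $\mathbb{M}$ such that $\operatorname{Aut}_{\mathrm{Part}}(\mathbb{M})\cong H$.
   Context: For a set $X$, $\mathbb{W}(X)$ is the free monoid of words on $X$, $\circ$ is concatenation, $\emptyset$ the empty word, and $X$ is identified with the words of length 1. A partial monoid is a triple $(\mathcal{M},\mathbb{D},\Pi)$ where $\mathcal{M}$ is a non-empty set, $\mathbb{D}\subseteq\mathbb{W}(\mathcal{M})$ satisfies $\mathcal{M}\subseteq\mathbb{D}$ and ($u\circ v\in\mathbb{D}\Rightarrow u,v\in\mathbb{D}$) (in particular $\emptyset\in\mathbb{D}$), and $\Pi\colon\mathbb{D}\to\mathcal{M}$ restricts to the identity on $\mathcal{M}$ and is such that if $u\circ v\circ w\in\mathbb{D}$ then $u\circ\Pi(v)\circ w\in\mathbb{D}$ and $\Pi(u\circ v\circ w)=\Pi(u\circ\Pi(v)\circ w)$. The unit is $1=\Pi(\emptyset)$. A partial group is a tuple $\mathbb{M}=(\mathcal{M},\mathbb{D},\Pi,(-)^{-1})$ where $(\mathcal{M},\mathbb{D},\Pi)$ is a partial monoid and $x\mapsto x^{-1}$ is an involutory bijection of $\mathcal{M}$, extended to words by $(x_1,\dots,x_n)^{-1}=(x_n^{-1},\dots,x_1^{-1})$, such that if $u\in\mathbb{D}$ then $u^{-1}\circ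 u\in\mathbb{D}$ and $\Pi(u^{-1}\circ u)=1$. A homomorphism of partial groups from $(\mathcal{M}_1,\mathbb{D}_1,\Pi_1,(-)^{-1})$ to $(\mathcal{M}_2,\mathbb{D}_2,\Pi_2,(-)^{-1})$ is a map $\varphi\colon\mathcal{M}_1\to\mathcal{M}_2$ whose letterwise extension $\overline{\varphi}$ to words satisfies $\overline{\varphi}(\mathbb{D}_1)\subseteq\mathbb{D}_2$ and $\Pi_2(\overline{\varphi}(u))=\varphi(\Pi_1(u))$ for all $u\in\mathbb{D}_1$. It is an isomorphism if it is bijective and $\varphi^{-1}$ is also a homomorphism. $\mathrm{Part}$ is the category of partial groups and these homomorphisms; $\operatorname{Aut}_{\mathrm{Part}}(\mathbb{M})$ is the group of automorphisms of $\mathbb{M}$ in it. A category $\mathcal{C}$ is universal if for every group $H$ there is an object $X$ of $\mathcal{C}$ with $\operatorname{Aut}_{\mathcal{C}}(X)\cong H$. *)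

theory Defs
  imports "HOL-Algebra.Bij"
begin

text \<open>
  Words on \<open>\<M>\<close> are lists with entries in the carrier, and \<open>x \<in> \<M>\<close> is identified
  with the singleton list \<open>[x]\<close>. The values of \<open>wprod\<close> outside \<open>wdom\<close>, and of
  \<open>winv\<close> outside the carrier, are irrelevant.
\<close>

record 'a partial_monoid = "'a partial_object" +
  wdom :: "'a list set"
  wprod :: "'a list \<Rightarrow> 'a"

record 'a partial_group = "'a partial_monoid" +
  winv :: "'a \<Rightarrow> 'a"

locale partial_monoid =
  fixes M :: "('a, 'm) partial_monoid_scheme" (structure)
  assumes carrier_nonempty: "carrier M \<noteq> {}"
    and wdom_subset: "wdom M \<subseteq> lists (carrier M)"
    and singleton_in_wdom: "x \<in> carrier M \<Longrightarrow> [x] \<in> wdom M"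
    and wdom_append: "u @ v \<in> wdom M \<Longrightarrow> u \<in> wdom M \<and> v \<in> wdom M"
    and wprod_closed: "wprod M \<in> wdom M \<rightarrow> carrier M"
    and wprod_singleton: "x \<in> carrier M \<Longrightarrow> wprod M [x] = x"
    and wdom_contract: "u @ v @ w \<in> wdom M \<Longrightarrow> u @ [wprod M v] @ w \<in> wdom M"
    and wprod_contract:
      "u @ v @ w \<in> wdom M \<Longrightarrow> wprod M (u @ v @ w) = wprod M (u @ [wprod M v] @ w)"

definition punit :: "('a, 'm) partial_monoid_scheme \<Rightarrow> 'a"
  where "punit M = wprod M []"

definition word_inv :: "('a, 'm) partial_group_scheme \<Rightarrow> 'a list \<Rightarrow> 'a list"
  where "word_inv M u = rev (map (winv M) u)"

locale partial_group = partial_monoid M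
  for M :: "('a, 'm) partial_group_scheme" (structure) +
  assumes winv_bij: "bij_betw (winv M) (carrier M) (carrier M)"
    and winv_winv: "x \<in> carrier M \<Longrightarrow> winv M (winv M x) = x"
    and word_inv_append: "u \<in> wdom M \<Longrightarrow> word_inv M u @ u \<in> wdom M"
    and wprod_word_inv: "u \<in> wdom M \<Longrightarrow> wprod M (word_inv M u @ u) = punit M"

definition part_hom ::
    "('a, 'm) partial_group_scheme \<Rightarrow> ('b, 'n) partial_group_scheme \<Rightarrow> ('a \<Rightarrow> 'b) set"
  where "part_hom M N =
    {\<phi> \<in> carrier M \<rightarrow> carrier N.
      map \<phi> ` wdom M \<subseteq> wdom N \<and> (\<forall>u \<in> wdom M. wprod N (map \<phi> u) = \<phi> (wprod M u))}"

definition part_iso ::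
    "('a, 'm) partial_group_scheme \<Rightarrow> ('b, 'n) partial_group_scheme \<Rightarrow> ('a \<Rightarrow> 'b) set"
  where "part_iso M N =
    {\<phi> \<in> part_hom M N.
      bij_betw \<phi> (carrier M) (carrier N) \<and> inv_into (carrier M) \<phi> \<in> part_hom N M}"

definition part_isomorphic ::
    "('a, 'm) partial_group_scheme \<Rightarrow> ('b, 'n) partial_group_scheme \<Rightarrow> bool"
  where "part_isomorphic M N \<longleftrightarrow> part_iso M N \<noteq> {}"

text \<open>
  As for \<^const>\<open>AutoGroup\<close>, an automorphism is represented by the function that is
  \<^const>\<open>undefined\<close> outside the carrier, so that each automorphism is counted once.
\<close>

definition part_Aut :: "('a, 'm) partial_group_scheme \<Rightarrow> ('a \<Rightarrow> 'a) monoid"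
  where "part_Aut M = BijGroup (carrier M) \<lparr>carrier := part_iso M M \<inter> Bij (carrier M)\<rparr>"

lemma part_hom_restrict:
  assumes "wdom M \<subseteq> lists (carrier M)" "wprod M \<in> wdom M \<rightarrow> carrier M"
    and "\<And>x. x \<in> carrier M \<Longrightarrow> f x = g x" "f \<in> part_hom M N"
  shows "g \<in> part_hom M N"
proof -
  have m: "map g u = map f u" if "u \<in> wdom M" for u
    using that assms(1,3) by (auto simp: map_eq_conv)
  have p: "f (wprod M u) = g (wprod M u)" if "u \<in> wdom M" for u
    using that assms(2,3) by auto
  show ?thesis
    using assms(3,4) m p by (auto simp: part_hom_def Pi_iff image_subset_iff simp del: map_eq_conv)
qed

lemma part_hom_comp:
  assumes "f \<in> part_hom M N" "g \<in> part_hom N P"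
  shows "g \<circ> f \<in> part_hom M P"
proof -
  have m: "map (g \<circ> f) u = map g (map f u)" for u by simp
  show ?thesis
    using assms unfolding part_hom_def m mem_Collect_eq image_subset_iff
    by (auto simp: Pi_iff simp del: map_map)
qed

lemma (in partial_group) group_part_Aut: "group (part_Aut M)"
proof -
  let ?C = "carrier M"
  interpret B: group "BijGroup ?C" by (rule group_BijGroup)
  have cong: "g \<in> part_hom M M"
    if "f \<in> part_hom M M" "\<And>x. x \<in> ?C \<Longrightarrow> f x = g x" for f g
    using part_hom_restrict[OF wdom_subset wprod_closed, of f g M] that by blast
  have bij: "bij_betw f ?C ?C" if "f \<in> Bij ?C" for f
    using that by (simp add: Bij_def)
  have inv_bij: "(\<lambda>x\<in>?C. inv_into ?C f x) \<in> Bij ?C" if "f \<in> Bij ?C" for f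
    using that by (rule restrict_inv_into_Bij)
  have memI: "f \<in> part_iso M M \<inter> Bij ?C"
    if "f \<in> Bij ?C" "f \<in> part_hom M M" "inv_into ?C f \<in> part_hom M M" for f
    using that bij by (auto simp: part_iso_def)
  have "subgroup (part_iso M M \<inter> Bij ?C) (BijGroup ?C)"
  proof (rule B.subgroupI)
    show "part_iso M M \<inter> Bij ?C \<subseteq> carrier (BijGroup ?C)"
      by (simp add: BijGroup_def)
    have id: "(\<lambda>x. x) \<in> part_hom M M"
      by (simp add: part_hom_def)
    have "(\<lambda>x\<in>?C. x) \<in> part_iso M M \<inter> Bij ?C"
    proof (rule memI)
      show b: "(\<lambda>x\<in>?C. x) \<in> Bij ?C" by (rule id_Bij)
      show "(\<lambda>x\<in>?C. x) \<in> part_hom M M" using id by (rule cong) simp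
      show "inv_into ?C (\<lambda>x\<in>?C. x) \<in> part_hom M M"
        using id
      proof (rule cong)
        fix x assume x: "x \<in> ?C"
        have "inv_into ?C (\<lambda>x\<in>?C. x) ((\<lambda>x\<in>?C. x) x) = x"
          using x by (intro inv_into_f_f) (auto simp: inj_on_def)
        then show "x = inv_into ?C (\<lambda>x\<in>?C. x) x" using x by simp
      qed
    qed
    then show "part_iso M M \<inter> Bij ?C \<noteq> {}" by blast
  next
    fix f assume f: "f \<in> part_iso M M \<inter> Bij ?C"
    let ?g = "\<lambda>x\<in>?C. inv_into ?C f x"
    have b: "bij_betw f ?C ?C" using f bij by blast
    have "?g \<in> part_iso M M \<inter> Bij ?C"
    proof (rule memI)
      show gb: "?g \<in> Bij ?C" using f inv_bij by blast
      have "inv_into ?C f \<in> part_hom M M" using f by (simp add: part_iso_def)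
      then show "?g \<in> part_hom M M" by (rule cong) simp
      have "f \<in> part_hom M M" using f by (simp add: part_iso_def)
      then show "inv_into ?C ?g \<in> part_hom M M"
      proof (rule cong)
        fix x assume x: "x \<in> ?C"
        have fx: "f x \<in> ?C" using b x by (auto simp: bij_betw_def)
        have "?g (f x) = x" using b x fx by (simp add: bij_betw_def)
        moreover have "inj_on ?g ?C" using bij[OF gb] by (simp add: bij_betw_def)
        ultimately show "f x = inv_into ?C ?g x" using fx by (metis inv_into_f_f)
      qed
    qed
    then show "inv\<^bsub>BijGroup ?C\<^esub> f \<in> part_iso M M \<inter> Bij ?C"
      using f by (simp add: inv_BijGroup)
  next
    fix f g assume f: "f \<in> part_iso M M \<inter> Bij ?C" and g: "g \<in> part_iso M M \<inter> Bij ?C"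
    have bf: "bij_betw f ?C ?C" and bg: "bij_betw g ?C ?C" using f g bij by blast+
    have "compose ?C f g \<in> part_iso M M \<inter> Bij ?C"
    proof (rule memI)
      show cb: "compose ?C f g \<in> Bij ?C" using f g by (intro compose_Bij) auto
      have "f \<circ> g \<in> part_hom M M"
        using f g by (intro part_hom_comp[of g M M]) (auto simp: part_iso_def)
      then show "compose ?C f g \<in> part_hom M M" by (rule cong) (simp add: compose_def)
      have "inv_into ?C g \<circ> inv_into ?C f \<in> part_hom M M"
        using f g by (intro part_hom_comp[of _ M M]) (auto simp: part_iso_def)
      then show "inv_into ?C (compose ?C f g) \<in> part_hom M M"
      proof (rule cong)
        fix x assume x: "x \<in> ?C"
        let ?y = "inv_into ?C g (inv_into ?C f x)"
        have fx: "inv_into ?C f x \<in> ?C" "f (inv_into ?C f x) = x"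
          using bf x by (auto simp: bij_betw_def inv_into_into f_inv_into_f)
        have y: "?y \<in> ?C" "g ?y = inv_into ?C f x"
          using bg fx(1) by (auto simp: bij_betw_def inv_into_into f_inv_into_f)
        have "compose ?C f g ?y = x" using y fx by (simp add: compose_def)
        moreover have "inj_on (compose ?C f g) ?C"
          using bij[OF cb] by (simp add: bij_betw_def)
        ultimately show "(inv_into ?C g \<circ> inv_into ?C f) x = inv_into ?C (compose ?C f g) x"
          using y(1) by (metis comp_apply inv_into_f_f)
      qed
    qed
    then show "f \<otimes>\<^bsub>BijGroup ?C\<^esub> g \<in> part_iso M M \<inter> Bij ?C"
      using f g by (simp add: BijGroup_def)
  qed
  then show ?thesis
    unfolding part_Aut_def by (rule B.subgroup_imp_group)
qed

end

theory Submission
  imports Defs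
begin

text \<open>
  A partial group behaves like a simplicial complex whose vertices have all been identified. Given a
  complex \<open>K\<close>, take as elements the directed edges \<open>\<delta> a b\<close> of \<open>K\<close>, with every degenerate edge
  \<open>\<delta> a a\<close> equal to the unit, as admissible words the successive edges of a path whose vertices
  span a simplex, and as product of such a word the edge from the first to the last vertex. This
  is a partial group, the \<open>edge_group\<close> of \<open>K\<close> (\<open>partial_group_edge_group\<close>). Identifying the
  vertices loses nothing if \<open>K\<close> contains every set of at most three vertices: for \<open>a \<noteq> b \<noteq> d\<close> the
  word \<open>\<delta> a b, \<delta> b d\<close> is then admissible, so its image is too, and the images of two edges that
  meet in \<open>b\<close> again meet in a vertex, which is the image of \<open>b\<close>. Therefore isomorphisms of edge
  groups are the same as isomorphisms of complexes (\<open>iso_simplicial\<close>), and what remains is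
  a problem about hypergraphs, namely to choose suitable simplices with at least four vertices.

  For that, recall Cayley's colour graph: a permutation of the group \<open>H\<close> that preserves the
  relation \<open>h = g x\<close> for each fixed colour \<open>x\<close> is a left translation. To keep the relation directed,
  \<open>g\<close> and \<open>h\<close> are taken from two copies of \<open>H\<close>, called sources and targets. To fix the colours,
  they are indexed by a wellordered set, on which only the identity preserves the order; the
  order is encoded by a further sort of vertices, the cuts, where the cut at \<open>w\<close> is joined to the
  colours \<open>\<ge> w\<close> (\<open>wellorder_rigid\<close>). The four sorts are told apart by the dimensions and the
  shapes of the simplices. One kind of simplex singles out the sources with the help
  of a fixed cut numbered \<open>k\<close>. As cuts cannot move, different \<open>k\<close> give non-isomorphic
  complexes (\<open>complex_iso_translate\<close>), hence infinitely many partial groups.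
\<close>

section \<open>Isomorphisms of partial groups\<close>

lemma part_isoI:
  assumes "partial_monoid M" "partial_monoid N"
    and f: "f \<in> part_hom M N" and g: "g \<in> part_hom N M"
    and gf: "\<And>x. x \<in> carrier M \<Longrightarrow> g (f x) = x" and fg: "\<And>y. y \<in> carrier N \<Longrightarrow> f (g y) = y"
  shows "f \<in> part_iso M N"
proof -
  interpret N: partial_monoid N by fact
  have maps: "f \<in> carrier M \<rightarrow> carrier N" "g \<in> carrier N \<rightarrow> carrier M"
    using f g by (auto simp: part_hom_def)
  have bij: "bij_betw f (carrier M) (carrier N)"
    using maps gf fg by (intro bij_betwI[where g = g]) auto
  have "inv_into (carrier M) f y = g y" if "y \<in> carrier N" for y
    using that maps fg bij by (metis PiE bij_betw_imp_inj_on inv_into_f_f)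
  then have "inv_into (carrier M) f \<in> part_hom N M"
    using part_hom_restrict[OF N.wdom_subset N.wprod_closed _ g] by simp
  with f bij show ?thesis by (simp add: part_iso_def)
qed

section \<open>The partial group of directed edges of a simplicial complex\<close>

text \<open>
  The axiom makes \<open>\<delta>\<close> injective on pairs of distinct vertices and collapses the diagonal to one
  further value, as a difference \<open>b - a\<close> of independent vectors would. Leaving \<open>\<delta>\<close> abstract lets
  the edges be elements of an arbitrary type that is large enough to hold the pairs of vertices.
\<close>
locale vertex_difference =
  fixes \<delta> :: "'v \<Rightarrow> 'v \<Rightarrow> 'd"
  assumes diff_eq_iff: "\<delta> a b = \<delta> c d \<longleftrightarrow> a = c \<and> b = d \<or> a = b \<and> c = d"
begin

fun diffs :: "'v list \<Rightarrow> 'd list" where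
  "diffs (a # b # vs) = \<delta> a b # diffs (b # vs)"
| "diffs _ = []"

lemma length_diffs [simp]: "length (diffs vs) = length vs - 1"
  by (induction vs rule: diffs.induct) auto

lemma diffs_append: "diffs (xs @ m # ys) = diffs (xs @ [m]) @ diffs (m # ys)"
proof (induction xs)
  case (Cons x xs)
  then show ?case by (cases xs) auto
qed simp

text \<open>
  A path has one vertex more than its word has letters; when the word is cut, the vertex at
  the cut belongs to both parts.
\<close>
lemma diffs_split:
  assumes "diffs vs = u @ v" "vs \<noteq> []"
  obtains xs m ys where "vs = xs @ m # ys" "diffs (xs @ [m]) = u" "diffs (m # ys) = v"
proof -
  let ?n = "length u"
  have "length u + length v = length vs - 1"
    using assms(1) by (metis length_append length_diffs)
  then have n: "?n < length vs" using assms(2) by (cases vs) auto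
  define xs m ys where "xs = take ?n vs" and "m = vs ! ?n" and "ys = drop (Suc ?n) vs"
  have vs: "vs = xs @ m # ys" using n by (simp add: xs_def m_def ys_def id_take_nth_drop)
  have "diffs (xs @ [m]) @ diffs (m # ys) = u @ v" using vs assms(1) diffs_append by metis
  moreover have "length (diffs (xs @ [m])) = length u" using n by (simp add: xs_def)
  ultimately show ?thesis using vs that by (metis append_eq_append_conv)
qed

text \<open>
  A single letter other than the unit fixes its two vertices, and from there the path is determined
  in both directions. Only words of units leave the (constant) path undetermined.
\<close>
lemma diffs_eqD:
  assumes "diffs vs = diffs ws" "vs \<noteq> []" "ws \<noteq> []"
  shows "vs = ws \<or> (\<exists>n a b. vs = replicate (Suc n) a \<and> ws = replicate (Suc n) b)"
  using assms
proof (induction vs arbitrary: ws rule: diffs.induct)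
  case (1 a b vs)
  obtain c d ws' where ws: "ws = c # d # ws'"
    using "1.prems" by (cases ws rule: diffs.cases) auto
  have e: "\<delta> a b = \<delta> c d" and t: "diffs (b # vs) = diffs (d # ws')"
    using "1.prems"(1) ws by auto
  from "1.IH"[OF t] consider "b # vs = d # ws'"
    | n x y where "b # vs = replicate (Suc n) x" "d # ws' = replicate (Suc n) y" by blast
  then show ?case
  proof cases
    case 1
    then show ?thesis using e ws by (auto simp: diff_eq_iff)
  next
    case (2 n x y)
    from e show ?thesis unfolding diff_eq_iff
    proof
      assume "a = c \<and> b = d"
      then show ?thesis using 2 ws by auto
    next
      assume "a = b \<and> c = d"
      then have "a # b # vs = replicate (Suc (Suc n)) x" "ws = replicate (Suc (Suc n)) y"
        using 2 ws by auto
      then show ?thesis by blast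
    qed
  qed
next
  case ("2_2" v)
  then show ?case by (cases ws rule: diffs.cases) (auto intro!: exI[of _ 0])
qed auto

lemma diff_ends_cong:
  assumes "diffs vs = diffs ws" "vs \<noteq> []" "ws \<noteq> []"
  shows "\<delta> (hd vs) (last vs) = \<delta> (hd ws) (last ws)"
  using diffs_eqD[OF assms] by (auto simp: diff_eq_iff simp del: replicate_Suc)

text \<open>
  On the unit the two choices agree, since they come from one diagonal pair. Which vertex is
  chosen then does not matter for \<open>flip\<close> and \<open>lift\<close>, which return the unit again.
\<close>
definition src :: "'d \<Rightarrow> 'v" where "src x = fst (SOME p. x = \<delta> (fst p) (snd p))"
definition tgt :: "'d \<Rightarrow> 'v" where "tgt x = snd (SOME p. x = \<delta> (fst p) (snd p))"

lemma diff_src_tgt: "\<delta> (src (\<delta> a b)) (tgt (\<delta> a b)) = \<delta> a b"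
  unfolding src_def tgt_def by (rule someI2[of _ "(a, b)"]) auto

lemma src_tgt: "a \<noteq> b \<Longrightarrow> src (\<delta> a b) = a" "a \<noteq> b \<Longrightarrow> tgt (\<delta> a b) = b"
  using diff_src_tgt[of a b] by (auto simp: diff_eq_iff)

definition flip :: "'d \<Rightarrow> 'd" where "flip x = \<delta> (tgt x) (src x)"

definition lift :: "('v \<Rightarrow> 'v) \<Rightarrow> 'd \<Rightarrow> 'd" where "lift f x = \<delta> (f (src x)) (f (tgt x))"

lemma flip_diff [simp]: "flip (\<delta> a b) = \<delta> b a"
  using diff_src_tgt[of a b] by (auto simp: flip_def diff_eq_iff)

lemma lift_diff [simp]: "lift f (\<delta> a b) = \<delta> (f a) (f b)"
  using diff_src_tgt[of a b] by (auto simp: lift_def diff_eq_iff)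

lemma map_lift_diffs: "map (lift f) (diffs vs) = diffs (map f vs)"
  by (induction vs rule: diffs.induct) auto

definition path_prod :: "'d list \<Rightarrow> 'd" where
  "path_prod u = (let vs = SOME vs. vs \<noteq> [] \<and> diffs vs = u in \<delta> (hd vs) (last vs))"

lemma path_prod_diffs: "vs \<noteq> [] \<Longrightarrow> path_prod (diffs vs) = \<delta> (hd vs) (last vs)"
  unfolding path_prod_def Let_def
  by (rule someI2[of _ vs]) (auto intro: diff_ends_cong)

definition edge_group :: "'v set set \<Rightarrow> 'd partial_group" where
  "edge_group K = \<lparr>carrier = {\<delta> a b |a b. {a, b} \<in> K},
     wdom = diffs ` {vs. vs \<noteq> [] \<and> set vs \<in> K}, wprod = path_prod, winv = flip\<rparr>"

lemma edge_group_simps [simp]: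
  "wprod (edge_group K) = path_prod" "winv (edge_group K) = flip"
  by (simp_all add: edge_group_def)

lemma carrier_edge_group: "x \<in> carrier (edge_group K) \<longleftrightarrow> (\<exists>a b. {a, b} \<in> K \<and> x = \<delta> a b)"
  by (auto simp: edge_group_def)

lemma wdom_edge_group:
  "u \<in> wdom (edge_group K) \<longleftrightarrow> (\<exists>vs. vs \<noteq> [] \<and> set vs \<in> K \<and> u = diffs vs)"
  by (auto simp: edge_group_def)

lemma diffs_in_wdom: "vs \<noteq> [] \<Longrightarrow> set vs \<in> K \<Longrightarrow> diffs vs \<in> wdom (edge_group K)"
  by (auto simp: wdom_edge_group)

lemma set_diffsD: "x \<in> set (diffs vs) \<Longrightarrow> \<exists>a b. {a, b} \<subseteq> set vs \<and> x = \<delta> a b"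
  by (induction vs rule: diffs.induct) auto

text \<open>Inverting a word means walking its path backwards.\<close>
lemma word_inv_diffs: "word_inv (edge_group K) (diffs vs) = diffs (rev vs)"
proof (induction vs rule: diffs.induct)
  case (1 a b vs)
  then show ?case
    using diffs_append[of "rev vs" b "[a]"] by (simp add: word_inv_def)
qed (auto simp: word_inv_def)

text \<open>
  Every axiom is an operation on paths: cutting a path, skipping the interior vertices of a segment
  (which is contraction), or running back along a path before following it. None of them
  adds a vertex, so closure of \<open>K\<close> under subsets suffices.
\<close>
lemma partial_group_edge_group:
  assumes sub: "\<And>S T. S \<in> K \<Longrightarrow> T \<subseteq> S \<Longrightarrow> T \<in> K" and v: "{v} \<in> K"
  shows "partial_group (edge_group K)"
proof (unfold_locales, goal_cases)
  case 1
  have "\<delta> v v \<in> carrier (edge_group K)" using v by (auto simp: carrier_edge_group intro!: exI[of _ v])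
  then show ?case by blast
next
  case 2
  show ?case
  proof
    fix u assume "u \<in> wdom (edge_group K)"
    then obtain vs where vs: "set vs \<in> K" "u = diffs vs" by (auto simp: wdom_edge_group)
    have "x \<in> carrier (edge_group K)" if x: "x \<in> set u" for x
    proof -
      obtain a b where ab: "{a, b} \<subseteq> set vs" "x = \<delta> a b" using set_diffsD x vs(2) by blast
      show ?thesis using sub[OF vs(1) ab(1)] ab(2) by (auto simp: carrier_edge_group)
    qed
    then show "u \<in> lists (carrier (edge_group K))" by (simp add: in_lists_conv_set)
  qed
next
  case (3 x)
  then obtain a b where "{a, b} \<in> K" "x = \<delta> a b" by (auto simp: carrier_edge_group)
  then show ?case using diffs_in_wdom[of "[a, b]" K] by simp
next
  case (4 u v)
  then obtain vs where vs: "vs \<noteq> []" "set vs \<in> K" "diffs vs = u @ v"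
    by (auto simp: wdom_edge_group)
  obtain xs m ys where s: "vs = xs @ m # ys" "diffs (xs @ [m]) = u" "diffs (m # ys) = v"
    using diffs_split[OF vs(3,1)] .
  have "set (xs @ [m]) \<in> K" "set (m # ys) \<in> K" using s(1) by (auto intro!: sub[OF vs(2)])
  then show ?case using s(2,3) diffs_in_wdom by blast
next
  case 5
  show ?case
  proof
    fix u assume "u \<in> wdom (edge_group K)"
    then obtain vs where vs: "vs \<noteq> []" "set vs \<in> K" "u = diffs vs" by (auto simp: wdom_edge_group)
    have "{hd vs, last vs} \<in> K" using vs by (intro sub[OF vs(2)]) auto
    then show "wprod (edge_group K) u \<in> carrier (edge_group K)"
      using vs by (auto simp: carrier_edge_group path_prod_diffs)
  qed
next
  case (6 x)
  then obtain a b where "x = \<delta> a b" by (auto simp: carrier_edge_group)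
  then show ?case using path_prod_diffs[of "[a, b]"] by simp
next
  case (9 )
  have "flip x \<in> carrier (edge_group K)" if "x \<in> carrier (edge_group K)" for x
    using that unfolding carrier_edge_group by (metis flip_diff insert_commute)
  then show ?case
    by (intro bij_betwI[where g = flip]) (auto simp: carrier_edge_group)
next
  case (10 x)
  then show ?case by (auto simp: carrier_edge_group)
next
  case (11 u)
  then obtain a vs where vs: "set (a # vs) \<in> K" "u = diffs (a # vs)"
    by (auto simp: wdom_edge_group neq_Nil_conv)
  have "word_inv (edge_group K) u @ u = diffs (rev vs @ a # vs)"
    using vs diffs_append[of "rev vs" a vs] by (simp add: word_inv_diffs)
  then show ?case using vs(1) diffs_in_wdom[of "rev vs @ a # vs" K] by simp
next
  case (12 u)
  then obtain a vs where vs: "set (a # vs) \<in> K" "u = diffs (a # vs)"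
    by (auto simp: wdom_edge_group neq_Nil_conv)
  have "word_inv (edge_group K) u @ u = diffs (rev vs @ a # vs)"
    using vs diffs_append[of "rev vs" a vs] by (simp add: word_inv_diffs)
  then show ?case
    using path_prod_diffs[of "rev vs @ a # vs"] path_prod_diffs[of "[a]"]
    by (auto simp: punit_def diff_eq_iff hd_append hd_rev)
next
  case (7 u v w)
  then obtain vs where vs: "vs \<noteq> []" "set vs \<in> K" "diffs vs = u @ v @ w"
    by (auto simp: wdom_edge_group)
  obtain xs m ys where s: "vs = xs @ m # ys" "diffs (xs @ [m]) = u" "diffs (m # ys) = v @ w"
    using diffs_split[OF vs(3,1)] .
  obtain xs' n zs where s': "m # ys = xs' @ n # zs" "diffs (xs' @ [n]) = v" "diffs (n # zs) = w"
    using diffs_split[OF s(3)] by blast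
  have v: "path_prod v = \<delta> m n"
    using path_prod_diffs[of "xs' @ [n]"] s' by (cases xs') auto
  have word: "diffs (xs @ m # n # zs) = u @ [path_prod v] @ w"
    using s s' v diffs_append[of xs m "n # zs"] by simp
  have "n \<in> set (m # ys)" "set zs \<subseteq> set (m # ys)" unfolding s'(1) by auto
  then have "set (xs @ m # n # zs) \<in> K" using s(1) by (intro sub[OF vs(2)]) auto
  then have "u @ [path_prod v] @ w \<in> wdom (edge_group K)"
    unfolding word[symmetric] by (intro diffs_in_wdom) auto
  then show ?case by simp
next
  case (8 u v w)
  then obtain vs where vs: "vs \<noteq> []" "set vs \<in> K" "diffs vs = u @ v @ w"
    by (auto simp: wdom_edge_group)
  obtain xs m ys where s: "vs = xs @ m # ys" "diffs (xs @ [m]) = u" "diffs (m # ys) = v @ w"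
    using diffs_split[OF vs(3,1)] .
  obtain xs' n zs where s': "m # ys = xs' @ n # zs" "diffs (xs' @ [n]) = v" "diffs (n # zs) = w"
    using diffs_split[OF s(3)] by blast
  have v: "path_prod v = \<delta> m n"
    using path_prod_diffs[of "xs' @ [n]"] s' by (cases xs') auto
  have word: "diffs (xs @ m # n # zs) = u @ [path_prod v] @ w"
    using s s' v diffs_append[of xs m "n # zs"] by simp
  have "last vs = last (n # zs)" using s(1) s'(1) by (metis last_appendR list.distinct(1))
  moreover have "hd vs = hd (xs @ m # n # zs)" using s(1) by (cases xs) auto
  ultimately have "path_prod (diffs vs) = path_prod (diffs (xs @ m # n # zs))"
    using vs(1) by (simp add: path_prod_diffs)
  then show ?case using vs(3) word by simp
qed

lemma lift_part_hom:
  assumes "\<And>S. S \<in> K \<Longrightarrow> f ` S \<in> L"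
  shows "lift f \<in> part_hom (edge_group K) (edge_group L)"
proof -
  have "lift f x \<in> carrier (edge_group L)" if "x \<in> carrier (edge_group K)" for x
    using that assms by (force simp: carrier_edge_group)
  moreover have "map (lift f) u \<in> wdom (edge_group L)
      \<and> path_prod (map (lift f) u) = lift f (path_prod u)"
    if u: "u \<in> wdom (edge_group K)" for u
  proof -
    obtain vs where vs: "vs \<noteq> []" "set vs \<in> K" "u = diffs vs"
      using u by (auto simp: wdom_edge_group)
    have "set (map f vs) \<in> L" using assms vs(2) by simp
    then show ?thesis using vs diffs_in_wdom[of "map f vs" L]
      by (simp add: map_lift_diffs path_prod_diffs hd_map last_map)
  qed
  ultimately show ?thesis by (auto simp: part_hom_def)
qed

text \<open>
  The vertex map is recovered from edges: \<open>f b\<close> is the common start of the images of all edges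
  starting at \<open>b\<close>. These images have a common start because each of them continues the image of any
  edge that ends at \<open>b\<close>, by the triangles in \<open>K\<close>. Injectivity of \<open>\<phi>\<close> keeps edges away from the
  unit, which has no well-defined end points.
\<close>
lemma injective_hom_simplicial:
  assumes K2: "\<And>S. S \<subseteq> V \<Longrightarrow> finite S \<Longrightarrow> card S \<le> 3 \<Longrightarrow> S \<in> K"
    and KV: "\<And>S. S \<in> K \<Longrightarrow> S \<subseteq> V \<and> finite S"
    and L2: "\<And>S. S \<subseteq> W \<Longrightarrow> finite S \<Longrightarrow> card S \<le> 3 \<Longrightarrow> S \<in> L"
    and LW: "\<And>S. S \<in> L \<Longrightarrow> S \<subseteq> W \<and> finite S"
    and two: "p \<in> V" "q \<in> V" "p \<noteq> q"
    and hom: "\<phi> \<in> part_hom (edge_group K) (edge_group L)"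
    and inj: "inj_on \<phi> (carrier (edge_group K))"
  obtains f where "f ` V \<subseteq> W" "inj_on f V" "\<And>S. S \<in> K \<Longrightarrow> f ` S \<in> L"
    and "\<And>a b. a \<in> V \<Longrightarrow> b \<in> V \<Longrightarrow> \<phi> (\<delta> a b) = \<delta> (f a) (f b)"
proof -
  have small: "set vs \<in> K" if "set vs \<subseteq> V" "length vs \<le> 3" for vs
    using that card_length[of vs] by (intro K2) auto
  have edge: "\<delta> a b \<in> carrier (edge_group K)" if "a \<in> V" "b \<in> V" for a b
    using small[of "[a, b]"] that by (auto simp: carrier_edge_group)
  have dom: "map \<phi> (diffs vs) \<in> wdom (edge_group L)" if "vs \<noteq> []" "set vs \<in> K" for vs
  proof -
    have "diffs vs \<in> wdom (edge_group K)" using that by (auto simp: wdom_edge_group)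
    then show ?thesis using hom by (auto simp: part_hom_def)
  qed
  have unit: "\<phi> (\<delta> a a) = \<delta> b b" for a b
  proof -
    have "[] \<in> wdom (edge_group K)"
      using small[of "[p]"] two by (auto simp: wdom_edge_group intro!: exI[of _ "[p]"])
    then have "path_prod [] = \<phi> (path_prod [])" using hom by (force simp: part_hom_def)
    then show ?thesis
      using path_prod_diffs[of "[a]"] path_prod_diffs[of "[b]"] by simp
  qed
  have nonunit: "\<exists>c d. c \<noteq> d \<and> c \<in> W \<and> d \<in> W \<and> \<phi> (\<delta> a b) = \<delta> c d"
    if "a \<in> V" "b \<in> V" "a \<noteq> b" for a b
  proof -
    have "\<phi> (\<delta> a b) \<in> carrier (edge_group L)"
      using hom edge[OF that(1,2)] by (auto simp: part_hom_def)
    then obtain c d where cd: "{c, d} \<in> L" "\<phi> (\<delta> a b) = \<delta> c d"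
      by (auto simp: carrier_edge_group)
    have "\<phi> (\<delta> a b) \<noteq> \<phi> (\<delta> a a)"
      using inj_onD[OF inj _ edge[OF that(1,2)] edge[OF that(1,1)]] that(3)
      by (auto simp: diff_eq_iff)
    then have "c \<noteq> d" using cd(2) unit[of a c] by auto
    then show ?thesis using cd LW[OF cd(1)] by auto
  qed
  have meet: "tgt (\<phi> (\<delta> a b)) = src (\<phi> (\<delta> b d))"
    if "a \<in> V" "b \<in> V" "d \<in> V" "a \<noteq> b" "b \<noteq> d" for a b d
  proof -
    have "map \<phi> (diffs [a, b, d]) \<in> wdom (edge_group L)"
      using that by (intro dom small) auto
    then obtain vs where vs: "map \<phi> (diffs [a, b, d]) = diffs vs" by (auto simp: wdom_edge_group)
    have "length vs - 1 = 2" using arg_cong[OF vs, of length] by simp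
    then have "length vs = Suc (Suc (Suc 0))" by simp
    then obtain x y z where "vs = [x, y, z]" by (auto simp: length_Suc_conv)
    then have xyz: "\<phi> (\<delta> a b) = \<delta> x y" "\<phi> (\<delta> b d) = \<delta> y z" using vs by auto
    have "x \<noteq> y" "y \<noteq> z"
      using nonunit[of a b] nonunit[of b d] that xyz by (auto simp: diff_eq_iff)
    then show ?thesis using xyz by (simp add: src_tgt)
  qed
  define other where "other v = (if v = p then q else p)" for v
  have other: "other v \<in> V" "other v \<noteq> v" for v using two by (auto simp: other_def)
  define f where "f v = src (\<phi> (\<delta> v (other v)))" for v
  (* The image of the edge from b back to a ends where the images of all edges at a start. *)
  have f_src: "src (\<phi> (\<delta> a b)) = f a" if "a \<in> V" "b \<in> V" "a \<noteq> b" for a b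
    using meet[of b a b] meet[of b a "other a"] that other[of a] by (simp add: f_def)
  have f_tgt: "tgt (\<phi> (\<delta> a b)) = f b" if "a \<in> V" "b \<in> V" "a \<noteq> b" for a b
    using meet[of a b a] f_src[of b a] that by simp
  have f: "\<phi> (\<delta> a b) = \<delta> (f a) (f b) \<and> f a \<noteq> f b \<and> f a \<in> W" if ab: "a \<in> V" "b \<in> V" "a \<noteq> b" for a b
  proof -
    obtain c d where "c \<noteq> d" "c \<in> W" "d \<in> W" "\<phi> (\<delta> a b) = \<delta> c d" using nonunit[OF ab] by blast
    then show ?thesis using f_src[OF ab] f_tgt[OF ab] by (auto simp: src_tgt)
  qed
  have im: "f ` V \<subseteq> W"
  proof
    fix w assume "w \<in> f ` V"
    then obtain v where "v \<in> V" "w = f v" by blast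
    then show "w \<in> W" using f[of v "other v"] other[of v] by simp
  qed
  have inj_f: "inj_on f V"
  proof (rule inj_onI)
    fix a b assume "a \<in> V" "b \<in> V" "f a = f b"
    then show "a = b" using f[of a b] by blast
  qed
  have diff: "\<phi> (\<delta> a b) = \<delta> (f a) (f b)" if "a \<in> V" "b \<in> V" for a b
    using f[OF that] unit[of a "f a"] by (cases "a = b") auto
  have "f ` S \<in> L" if S: "S \<in> K" for S
  (* A single vertex gives a word of units, from which the vertex cannot be read off. *)
  proof (cases "card S \<le> 1")
    case True
    have "card (f ` S) \<le> card S" using KV[OF S] by (simp add: card_image_le)
    then show ?thesis using True KV[OF S] im by (intro L2) auto
  next
    case False
    obtain vs where vs: "set vs = S" using KV[OF S] finite_list by blast
    have ne: "vs \<noteq> []" using vs False by auto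
    have "map \<phi> (diffs us) = diffs (map f us)" if "set us \<subseteq> V" for us
      using that by (induction us rule: diffs.induct) (auto simp: diff)
    then have "diffs (map f vs) \<in> wdom (edge_group L)"
      using dom[OF ne] vs S KV[OF S] by auto
    then obtain ws where ws: "ws \<noteq> []" "set ws \<in> L" "diffs (map f vs) = diffs ws"
      by (auto simp: wdom_edge_group)
    have "\<not> (\<exists>n a. map f vs = replicate (Suc n) a)"
    proof
      assume "\<exists>n a. map f vs = replicate (Suc n) a"
      then obtain n a where "map f vs = replicate (Suc n) a" by blast
      then have "f ` S = {a}" using vs by (metis set_map set_replicate nat.distinct(1))
      moreover have "card (f ` S) = card S"
        using inj_f KV[OF S] by (intro card_image) (auto intro: inj_on_subset)
      ultimately show False using False by simp
    qed
    then have "map f vs = ws" using diffs_eqD[OF ws(3)] ws(1) ne by auto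
    then show ?thesis using ws(2) vs by auto
  qed
  then show ?thesis using that im inj_f diff by blast
qed

lemma iso_simplicial:
  assumes K2: "\<And>S. S \<subseteq> V \<Longrightarrow> finite S \<Longrightarrow> card S \<le> 3 \<Longrightarrow> S \<in> K"
    and KV: "\<And>S. S \<in> K \<Longrightarrow> S \<subseteq> V \<and> finite S"
    and L2: "\<And>S. S \<subseteq> W \<Longrightarrow> finite S \<Longrightarrow> card S \<le> 3 \<Longrightarrow> S \<in> L"
    and LW: "\<And>S. S \<in> L \<Longrightarrow> S \<subseteq> W \<and> finite S"
    and two: "p \<in> V" "q \<in> V" "p \<noteq> q"
    and iso: "\<phi> \<in> part_iso (edge_group K) (edge_group L)"
  obtains f where "bij_betw f V W" "\<And>S. S \<subseteq> V \<Longrightarrow> f ` S \<in> L \<longleftrightarrow> S \<in> K"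
    and "\<And>a b. a \<in> V \<Longrightarrow> b \<in> V \<Longrightarrow> \<phi> (\<delta> a b) = \<delta> (f a) (f b)"
proof -
  let ?M = "edge_group K" and ?N = "edge_group L"
  define \<psi> where "\<psi> = inv_into (carrier ?M) \<phi>"
  have hom: "\<phi> \<in> part_hom ?M ?N" "\<psi> \<in> part_hom ?N ?M"
    and bij: "bij_betw \<phi> (carrier ?M) (carrier ?N)"
    using iso by (auto simp: part_iso_def \<psi>_def)
  have bij': "bij_betw \<psi> (carrier ?N) (carrier ?M)"
    using bij by (simp add: \<psi>_def bij_betw_inv_into)
  obtain f where f: "f ` V \<subseteq> W" "inj_on f V" "\<And>S. S \<in> K \<Longrightarrow> f ` S \<in> L"
    "\<And>a b. a \<in> V \<Longrightarrow> b \<in> V \<Longrightarrow> \<phi> (\<delta> a b) = \<delta> (f a) (f b)"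
    using injective_hom_simplicial[OF K2 KV L2 LW two hom(1) bij_betw_imp_inj_on[OF bij]] by blast
  have two': "f p \<in> W" "f q \<in> W" "f p \<noteq> f q" using f(1,2) two by (auto dest: inj_onD)
  obtain g where g: "g ` W \<subseteq> V" "inj_on g W" "\<And>S. S \<in> L \<Longrightarrow> g ` S \<in> K"
    "\<And>a b. a \<in> W \<Longrightarrow> b \<in> W \<Longrightarrow> \<psi> (\<delta> a b) = \<delta> (g a) (g b)"
    using injective_hom_simplicial[OF L2 LW K2 KV two' hom(2) bij_betw_imp_inj_on[OF bij']] by blast
  have gf: "g (f a) = a" if a: "a \<in> V" for a
  proof -
    obtain b where b: "b \<in> V" "a \<noteq> b" using two by blast
    have "{a, b} \<in> K" using K2[of "{a, b}"] a b by auto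
    then have "\<delta> a b \<in> carrier ?M" by (auto simp: carrier_edge_group)
    then have "\<psi> (\<phi> (\<delta> a b)) = \<delta> a b"
      using bij by (simp add: \<psi>_def bij_betw_inv_into_left)
    moreover have "f a \<in> W" "f b \<in> W" using f(1) a b(1) by auto
    ultimately have "\<delta> (g (f a)) (g (f b)) = \<delta> a b" using f(4)[OF a b(1)] g(4) by simp
    then show ?thesis using b by (auto simp: diff_eq_iff)
  qed
  have fg: "f (g c) = c" if "c \<in> W" for c
    using gf[of "g c"] that f(1) g(1,2) by (meson image_subset_iff inj_on_eq_iff)
  have "bij_betw f V W" by (rule bij_betwI[where g = g]) (use f(1) g(1) gf fg in auto)
  moreover have "f ` S \<in> L \<longleftrightarrow> S \<in> K" if "S \<subseteq> V" for S
  proof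
    assume "f ` S \<in> L"
    from g(3)[OF this] show "S \<in> K" using that gf by (force simp: image_image subset_iff)
  qed (rule f(3))
  ultimately show ?thesis using that f(4) by blast
qed

end


section \<open>Wellorders are rigid\<close>

text \<open>
  The relation between cuts and colours is not an order but the bipartite graph of one, and the
  two sides are permuted independently. Induction works on both at once: below \<open>z\<close> everything is fixed,
  so neither permutation can send an element \<open>\<ge> z\<close> below \<open>z\<close>. The preimage \<open>w\<close> of \<open>z\<close> under \<open>\<alpha>\<close>
  satisfies \<open>z \<le> w\<close>, and comparing \<open>\<beta> z\<close> and \<open>\<beta> w\<close> with \<open>\<alpha> w = z\<close> forces both to be \<open>z\<close>.
\<close>
lemma wellorder_rigid:
  fixes r :: "'w rel"
  assumes wo: "well_order_on UNIV r"
    and bij: "bij \<alpha>" "bij \<beta>" and cut: "\<And>w x. (w, x) \<in> r \<longleftrightarrow> (\<beta> w, \<alpha> x) \<in> r"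
  shows "\<alpha> z = z \<and> \<beta> z = z"
proof -
  have wf: "wf (r - Id)" using wo by (simp add: well_order_on_def)
  have total: "(x, y) \<in> r - Id \<or> (y, x) \<in> r" for x y
    using wo by (cases "x = y") (auto simp: well_order_on_def linear_order_on_def
        partial_order_on_def preorder_on_def total_on_def refl_on_def)
  have antisym: "x = y" if "(x, y) \<in> r" "(y, x) \<in> r" for x y
    using wo that by (auto simp: well_order_on_def linear_order_on_def partial_order_on_def antisym_def)
  show ?thesis
  proof (induction z rule: wf_induct_rule[OF wf])
    case (1 z)
    have ge: "(z, \<gamma> w) \<in> r" if "\<gamma> = \<alpha> \<or> \<gamma> = \<beta>" "(z, w) \<in> r" for \<gamma> w
    proof (rule ccontr)
      assume "(z, \<gamma> w) \<notin> r"
      then have less: "(\<gamma> w, z) \<in> r - Id" using total by blast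
      then have "\<gamma> (\<gamma> w) = \<gamma> w" using 1 that(1) by blast
      then have "\<gamma> w = w" using bij that(1) by (auto dest: bij_is_inj injD)
      then show False using less that(2) antisym by auto
    qed
    have refl: "(z, z) \<in> r" using total[of z z] by auto
    obtain w where w: "\<alpha> w = z" using bij(1) by (metis bij_pointE)
    have zw: "(z, w) \<in> r"
    proof (rule ccontr)
      assume "(z, w) \<notin> r"
      then have less: "(w, z) \<in> r - Id" using total by blast
      then have "\<alpha> w = w" using 1 by blast
      then show False using less w by simp
    qed
    have "(\<beta> z, z) \<in> r" using cut zw w by blast
    then have \<beta>z: "\<beta> z = z" using ge[of \<beta> z] refl antisym by blast
    have "(w, w) \<in> r" using total[of w w] by auto
    then have "(\<beta> w, z) \<in> r" using cut w by metis
    then have "\<beta> w = z" using ge[of \<beta> w] zw antisym by blast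
    then have "w = z" using \<beta>z bij(2) by (metis bij_pointE)
    with w \<beta>z show ?case by simp
  qed
qed

section \<open>A simplicial complex with prescribed automorphism group\<close>

datatype ('g, 'w) vertex = Source 'g | Target 'g | Colour 'w | Cut 'w

text \<open>
  Colours and cuts are indexed by \<open>'a + nat\<close>: the left summand colours Cayley edges, and the right one
  supplies infinitely many fixed vertices that serve as labels. Without a top element, every
  cut has at least three colours above it, as many as a simplex of the first kind below needs.
\<close>
locale coloured_cayley = group H for H :: "('a, 'h) monoid_scheme" (structure) +
  fixes r :: "('a + nat) rel"
  assumes wo: "well_order_on UNIV r"
    and no_top: "\<And>x. \<exists>y. y \<noteq> x \<and> (x, y) \<in> r"
begin

text \<open>
  The simplices that carry the information. All sets of at most three vertices are simplices anyway,
  so each kind has four vertices; extra colours and the cut at \<open>Inr 0\<close> pad to that size.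
\<close>
inductive_set facets :: "nat \<Rightarrow> ('a, 'a + nat) vertex set set" for k where
  cut: "\<lbrakk>distinct [x, y, z]; (w, x) \<in> r; (w, y) \<in> r; (w, z) \<in> r\<rbrakk>
    \<Longrightarrow> {Cut w, Colour x, Colour y, Colour z} \<in> facets k"
| source: "g \<in> carrier H
    \<Longrightarrow> {Source g, Cut (Inr k), Colour (Inr 0), Colour (Inr 1)} \<in> facets k"
| cayley: "\<lbrakk>g \<in> carrier H; x \<in> carrier H\<rbrakk>
    \<Longrightarrow> {Source g, Target (g \<otimes> x), Colour (Inl x), Cut (Inr 0)} \<in> facets k"

definition vertices :: "('a, 'a + nat) vertex set" where
  "vertices = Source ` carrier H \<union> Target ` carrier H \<union> range Colour \<union> range Cut"

text \<open>
  Filling in all finite sets of colours marks the colours as the only vertices that lie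
  in simplices of high dimension.
\<close>
definition cayley_complex :: "nat \<Rightarrow> ('a, 'a + nat) vertex set set" where
  "cayley_complex k =
    {S. S \<subseteq> vertices \<and> finite S \<and> (card S \<le> 3 \<or> S \<subseteq> range Colour \<or> S \<in> facets k)}"

lemma card_facet: "S \<in> facets k \<Longrightarrow> card S = 4"
  by (induction rule: facets.induct) auto

lemma cayley_complex_subset:
  assumes S: "S \<in> cayley_complex k" and T: "T \<subseteq> S"
  shows "T \<in> cayley_complex k"
proof -
  have fin: "finite S" using S by (simp add: cayley_complex_def)
  have "card T \<le> 3" if "T \<noteq> S" "card S \<le> 4"
    using psubset_card_mono[OF fin psubsetI[OF T that(1)]] that(2) by simp
  then show ?thesis
    using S T card_facet[of S k] finite_subset[OF T fin] unfolding cayley_complex_def by fastforce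
qed

lemma cayley_complexD: "S \<in> cayley_complex k \<Longrightarrow> S \<subseteq> vertices \<and> finite S"
  by (simp add: cayley_complex_def)

lemma cayley_complexI:
  "S \<subseteq> vertices \<Longrightarrow> finite S \<Longrightarrow> card S \<le> 3 \<Longrightarrow> S \<in> cayley_complex k"
  by (simp add: cayley_complex_def)

lemma facet_in_complex:
  assumes "S \<in> facets k" shows "S \<in> cayley_complex k"
proof -
  have "S \<subseteq> vertices" using assms by cases (auto simp: vertices_def)
  moreover have "finite S" using card_facet[OF assms] by (intro card_ge_0_finite) simp
  ultimately show ?thesis using assms by (simp add: cayley_complex_def)
qed

text \<open>
  The next results express sorts and relations through membership in the complex alone, so
  that isomorphisms of complexes have to respect them.
\<close>
lemma colour_iff:
  "v \<in> range Colour \<longleftrightarrow> (\<exists>S \<in> cayley_complex k. v \<in> S \<and> card S = 5)"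
proof
  assume "v \<in> range Colour"
  then obtain x where v: "v = Colour x" by blast
  have "infinite (UNIV - {x})" by simp
  then obtain X where X: "finite X" "card X = 4" "X \<subseteq> UNIV - {x}"
    using infinite_arbitrarily_large by metis
  have "card (insert x X) = 5" using X by (subst card_insert_disjoint) auto
  then have "card (Colour ` insert x X) = 5" by (subst card_image) (auto simp: inj_on_def)
  moreover have "Colour ` insert x X \<in> cayley_complex k"
    using X(1) by (auto simp: cayley_complex_def vertices_def)
  ultimately show "\<exists>S \<in> cayley_complex k. v \<in> S \<and> card S = 5"
    using v by (intro bexI[where x = "Colour ` insert x X"]) simp_all
next
  assume "\<exists>S \<in> cayley_complex k. v \<in> S \<and> card S = 5"
  then obtain S where S: "S \<in> cayley_complex k" "v \<in> S" "card S = 5" by blast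
  then have "S \<notin> facets k" using card_facet[of S k] by auto
  then show "v \<in> range Colour" using S by (auto simp: cayley_complex_def)
qed

lemma four_simplex_facet:
  assumes "S \<in> cayley_complex k" "card S = 4" "v \<in> S" "v \<notin> range Colour"
  shows "S \<in> facets k"
  using assms by (auto simp: cayley_complex_def)

lemma cut_iff:
  assumes "v \<notin> range Colour" "distinct [x, y, z]"
  shows "{v, Colour x, Colour y, Colour z} \<in> cayley_complex k \<longleftrightarrow>
    (\<exists>w. v = Cut w \<and> (w, x) \<in> r \<and> (w, y) \<in> r \<and> (w, z) \<in> r)"
proof
  let ?S = "{v, Colour x, Colour y, Colour z}"
  assume S: "?S \<in> cayley_complex k"
  have "v \<noteq> Colour u" for u using assms(1) by blast
  then have "card ?S = 4" using assms(2) by auto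
  then have "?S \<in> facets k" using four_simplex_facet[OF S _ _ assms(1)] by simp
  then show "\<exists>w. v = Cut w \<and> (w, x) \<in> r \<and> (w, y) \<in> r \<and> (w, z) \<in> r"
  proof cases
    case (cut x' y' z' w)
    have "v \<in> ?S" "Colour x \<in> ?S" "Colour y \<in> ?S" "Colour z \<in> ?S" by auto
    then show ?thesis unfolding cut(1) using cut(2-) assms by auto
  next
    case (source g)
    have "Source g \<in> ?S" "Cut (Inr k) \<in> ?S" unfolding source(1) by auto
    then show ?thesis by auto
  next
    case (cayley g x')
    have "Source g \<in> ?S" "Target (g \<otimes> x') \<in> ?S" unfolding cayley(1) by auto
    then show ?thesis by auto
  qed
next
  assume "\<exists>w. v = Cut w \<and> (w, x) \<in> r \<and> (w, y) \<in> r \<and> (w, z) \<in> r"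
  then show "{v, Colour x, Colour y, Colour z} \<in> cayley_complex k"
    using facet_in_complex[OF facets.cut[OF assms(2)]] by blast
qed

lemma source_iff:
  assumes "v \<notin> range Colour" "v \<notin> range Cut"
  shows "{v, Cut w, Colour (Inr 0), Colour (Inr 1)} \<in> cayley_complex k \<longleftrightarrow>
    v \<in> Source ` carrier H \<and> w = Inr k"
proof
  let ?S = "{v, Cut w, Colour (Inr 0), Colour (Inr 1)}"
  assume S: "?S \<in> cayley_complex k"
  have "v \<noteq> Colour u" "v \<noteq> Cut u" for u using assms by blast+
  then have "card ?S = 4" by auto
  then have "?S \<in> facets k" using four_simplex_facet[OF S _ _ assms(1)] by simp
  then show "v \<in> Source ` carrier H \<and> w = Inr k"
  proof cases
    case (cut x' y' z' w')
    have "v \<in> ?S" by auto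
    then show ?thesis unfolding cut(1) using assms by auto
  next
    case (source g)
    have "v \<in> ?S" "Cut w \<in> ?S" by auto
    then show ?thesis unfolding source(1) using source(2) assms by auto
  next
    case (cayley g x')
    have "Source g \<in> ?S" "Target (g \<otimes> x') \<in> ?S" unfolding cayley(1) by auto
    then show ?thesis by auto
  qed
qed (use facet_in_complex[OF facets.source] in blast)

lemma cayley_iff:
  assumes "g \<in> carrier H" "x \<in> carrier H"
  shows "{Source g, Target h, Colour (Inl x), Cut (Inr 0)} \<in> cayley_complex k \<longleftrightarrow> h = g \<otimes> x"
    (is "?S \<in> _ \<longleftrightarrow> _")
proof
  assume S: "?S \<in> cayley_complex k"
  have "card ?S = 4" by auto
  then have "?S \<in> facets k" using four_simplex_facet[OF S, of "Source g"] by auto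
  then show "h = g \<otimes> x"
  proof cases
    case (cut x' y' z' w')
    have "Source g \<in> ?S" by simp
    then show ?thesis unfolding cut(1) by simp
  next
    case (source g')
    have "Target h \<in> ?S" by simp
    then show ?thesis unfolding source(1) by simp
  next
    case (cayley g' x')
    have "Source g \<in> ?S" "Target h \<in> ?S" "Colour (Inl x) \<in> ?S" by simp_all
    then show ?thesis unfolding cayley(1) by simp
  qed
qed (use facet_in_complex[OF facets.cayley[OF assms]] in blast)

primrec translate :: "'a \<Rightarrow> ('a, 'a + nat) vertex \<Rightarrow> ('a, 'a + nat) vertex" where
  "translate a (Source g) = Source (a \<otimes> g)"
| "translate a (Target g) = Target (a \<otimes> g)"
| "translate a (Colour x) = Colour x"
| "translate a (Cut w) = Cut w"

lemma translate_closed: "a \<in> carrier H \<Longrightarrow> v \<in> vertices \<Longrightarrow> translate a v \<in> vertices"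
  by (auto simp: vertices_def)

lemma translate_mult:
  "a \<in> carrier H \<Longrightarrow> b \<in> carrier H \<Longrightarrow> v \<in> vertices
    \<Longrightarrow> translate a (translate b v) = translate (a \<otimes> b) v"
  by (auto simp: vertices_def m_assoc)

lemma translate_one: "v \<in> vertices \<Longrightarrow> translate \<one> v = v"
  by (auto simp: vertices_def)

lemma translate_facet:
  assumes "a \<in> carrier H" "S \<in> facets k"
  shows "translate a ` S \<in> facets k"
  using assms(2)
proof cases
  case (cut x y z w)
  then show ?thesis using facets.cut[OF cut(2-), of k] by simp
next
  case (source g)
  then show ?thesis using assms(1) facets.source[of "a \<otimes> g" k] by simp
next
  case (cayley g x)
  then show ?thesis using assms(1) facets.cayley[of "a \<otimes> g" x k] by (simp add: m_assoc)
qed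

lemma translate_complex:
  assumes a: "a \<in> carrier H" and S: "S \<in> cayley_complex k"
  shows "translate a ` S \<in> cayley_complex k"
proof -
  have S': "S \<subseteq> vertices" "finite S" "card S \<le> 3 \<or> S \<subseteq> range Colour \<or> S \<in> facets k"
    using S by (auto simp: cayley_complex_def)
  have "card (translate a ` S) \<le> card S" using S'(2) by (rule card_image_le)
  moreover have "translate a ` S \<subseteq> range Colour" if "S \<subseteq> range Colour" using that by auto
  moreover have "translate a ` S \<subseteq> vertices" using S'(1) translate_closed[OF a] by blast
  ultimately show ?thesis
    using S'(2,3) translate_facet[OF a] unfolding cayley_complex_def by fastforce
qed

lemma above_two:
  assumes "(w, x) \<in> r"
  obtains y z where "distinct [x, y, z]" "(w, y) \<in> r" "(w, z) \<in> r"
proof -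
  have trans: "trans r" and antisym: "antisym r"
    using wo by (auto simp: well_order_on_def linear_order_on_def partial_order_on_def preorder_on_def)
  obtain y where y: "y \<noteq> x" "(x, y) \<in> r" using no_top by blast
  obtain z where z: "z \<noteq> y" "(y, z) \<in> r" using no_top by blast
  have "z \<noteq> x" using y z antisym by (auto dest: antisymD)
  then show ?thesis using that[of y z] y z assms transD[OF trans]
    by (metis distinct_length_2_or_more distinct_singleton)
qed

text \<open>
  The sorts are recognised one after the other. Colours are preserved by their dimension, then cuts
  by their simplices with three colours, and wellorder rigidity fixes both sorts pointwise.
  Now fixed vertices can be used as labels: they show that \<open>k = l\<close> and that sources, hence also targets,
  are preserved. If \<open>f\<close> acts as \<open>\<sigma>\<close> on sources and as \<open>\<tau>\<close> on targets, the remaining simplices say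
  \<open>\<tau> (g x) = \<sigma> g x\<close>, so both maps are left multiplication by \<open>\<sigma> 1\<close>.
\<close>
lemma complex_iso_translate:
  assumes bij: "bij_betw f vertices vertices"
    and simp: "\<And>S. S \<subseteq> vertices \<Longrightarrow> f ` S \<in> cayley_complex l \<longleftrightarrow> S \<in> cayley_complex k"
  shows "k = l \<and> (\<exists>a \<in> carrier H. \<forall>v \<in> vertices. f v = translate a v)"
proof -
  have V: "Colour x \<in> vertices" "Cut w \<in> vertices" for x w by (auto simp: vertices_def)
  have inj: "inj_on f vertices" and fV: "f ` vertices = vertices"
    using bij by (auto simp: bij_betw_def)
  have f_in: "f v \<in> vertices" if "v \<in> vertices" for v using that fV by blast
  have colour: "f v \<in> range Colour \<longleftrightarrow> v \<in> range Colour" if v: "v \<in> vertices" for v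
  proof -
    have card: "card (f ` S) = card S" if "S \<subseteq> vertices" for S
      using inj_on_subset[OF inj that] by (rule card_image)
    have "(\<exists>T \<in> cayley_complex l. f v \<in> T \<and> card T = 5) \<longleftrightarrow>
        (\<exists>S \<in> cayley_complex k. v \<in> S \<and> card S = 5)"
    proof
      assume "\<exists>T \<in> cayley_complex l. f v \<in> T \<and> card T = 5"
      then obtain T where T: "T \<in> cayley_complex l" "f v \<in> T" "card T = 5" by blast
      have "T \<subseteq> f ` vertices" using cayley_complexD[OF T(1)] fV by simp
      then obtain S where S: "S \<subseteq> vertices" "T = f ` S" by (auto simp: subset_image_iff)
      then have "v \<in> S" using T(2) v inj by (auto dest: inj_onD)
      then show "\<exists>S \<in> cayley_complex k. v \<in> S \<and> card S = 5"
        using S T simp card by metis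
    next
      assume "\<exists>S \<in> cayley_complex k. v \<in> S \<and> card S = 5"
      then show "\<exists>T \<in> cayley_complex l. f v \<in> T \<and> card T = 5"
        using simp card cayley_complexD by (metis imageI)
    qed
    then show ?thesis by (simp only: colour_iff[of "f v" l] colour_iff[of v k])
  qed
  have "\<exists>\<alpha>. \<forall>x. f (Colour x) = Colour (\<alpha> x)" using colour V(1) by (intro choice) blast
  then obtain \<alpha> where \<alpha>: "\<And>x. f (Colour x) = Colour (\<alpha> x)" by blast
  have inj_\<alpha>: "inj \<alpha>"
  proof (rule injI)
    fix x y assume "\<alpha> x = \<alpha> y"
    then show "x = y" using inj_onD[OF inj _ V(1) V(1), of x y] \<alpha> by simp
  qed
  have surj_\<alpha>: "\<exists>x. y = \<alpha> x" for y
  proof -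
    obtain v where v: "v \<in> vertices" "f v = Colour y" using V(1)[of y] fV by (metis imageE)
    then have "v \<in> range Colour" using colour by (metis rangeI)
    then show ?thesis using v \<alpha> by auto
  qed
  have image4: "f ` {a, b, c, d} = {f a, f b, f c, f d}" for a b c d by auto
  (* A colour x lies above the cut at w exactly if some simplex contains x, two more colours and
     that cut; above_two provides the two colours on either side of f. *)
  have cut: "f v \<in> range Cut \<longleftrightarrow> v \<in> range Cut"
    and order: "\<And>w u. v = Cut w \<Longrightarrow> f v = Cut u \<Longrightarrow> (w, x) \<in> r \<longleftrightarrow> (u, \<alpha> x) \<in> r"
    if v: "v \<in> vertices" "v \<notin> range Colour" for v x
  proof -
    have fv: "f v \<notin> range Colour" using colour v by blast
    have step: "(\<exists>u. f v = Cut u \<and> (u, \<alpha> x) \<in> r \<and> (u, \<alpha> y) \<in> r \<and> (u, \<alpha> z) \<in> r) \<longleftrightarrow>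
        (\<exists>w. v = Cut w \<and> (w, x) \<in> r \<and> (w, y) \<in> r \<and> (w, z) \<in> r)"
      if "distinct [x, y, z]" for x y z
    proof -
      have "distinct [\<alpha> x, \<alpha> y, \<alpha> z]" using that inj_\<alpha> by (auto dest: injD)
      then show ?thesis
        using simp[of "{v, Colour x, Colour y, Colour z}"] v V(1) \<alpha> cut_iff[OF v(2) that, of k]
          cut_iff[OF fv, of "\<alpha> x" "\<alpha> y" "\<alpha> z" l]
        by (simp add: image4)
    qed
    have refl: "(w, w) \<in> r" for w
      using wo by (auto simp: well_order_on_def linear_order_on_def partial_order_on_def
          preorder_on_def refl_on_def)
    have fwd: "\<exists>u. f v = Cut u \<and> (u, \<alpha> x) \<in> r" if "v = Cut w" "(w, x) \<in> r" for w x
    proof -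
      obtain y z where "distinct [x, y, z]" "(w, y) \<in> r" "(w, z) \<in> r" using above_two[OF \<open>(w, x) \<in> r\<close>] .
      then show ?thesis using step that by blast
    qed
    have bwd: "\<exists>w. v = Cut w \<and> (w, x) \<in> r" if "f v = Cut u" "(u, \<alpha> x) \<in> r" for u x
    proof -
      obtain y' z' where yz: "distinct [\<alpha> x, y', z']" "(u, y') \<in> r" "(u, z') \<in> r"
        using above_two[OF \<open>(u, \<alpha> x) \<in> r\<close>] .
      obtain y z where yz': "y' = \<alpha> y" "z' = \<alpha> z" using surj_\<alpha> by blast
      then have "distinct [x, y, z]" using yz by auto
      then show ?thesis using step[of x y z] that yz yz' by blast
    qed
    show "f v \<in> range Cut \<longleftrightarrow> v \<in> range Cut"
    proof
      assume "f v \<in> range Cut"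
      then obtain u where u: "f v = Cut u" by blast
      obtain x where x: "u = \<alpha> x" using surj_\<alpha> by blast
      show "v \<in> range Cut" using bwd[OF u, of x] refl x by auto
    next
      assume "v \<in> range Cut"
      then show "f v \<in> range Cut" using fwd refl by blast
    qed
    show "\<And>w u. v = Cut w \<Longrightarrow> f v = Cut u \<Longrightarrow> (w, x) \<in> r \<longleftrightarrow> (u, \<alpha> x) \<in> r"
      using fwd bwd by fastforce
  qed
  have "\<exists>\<beta>. \<forall>w. f (Cut w) = Cut (\<beta> w)" using cut[OF V(2)] by (intro choice) blast
  then obtain \<beta> where \<beta>: "\<And>w. f (Cut w) = Cut (\<beta> w)" by blast
  have inj_\<beta>: "inj \<beta>"
  proof (rule injI)
    fix x y assume "\<beta> x = \<beta> y"
    then show "x = y" using inj_onD[OF inj _ V(2) V(2), of x y] \<beta> by simp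
  qed
  have surj_\<beta>: "\<exists>x. y = \<beta> x" for y
  proof -
    obtain v where v: "v \<in> vertices" "f v = Cut y" using V(2)[of y] fV by (metis imageE)
    then have "v \<notin> range Colour" using \<alpha> by auto
    then have "v \<in> range Cut" using cut v by (metis rangeI)
    then show ?thesis using v \<beta> by auto
  qed
  have "\<alpha> x = x \<and> \<beta> x = x" for x
  proof (rule wellorder_rigid[OF wo])
    show "bij \<alpha>" "bij \<beta>" using inj_\<alpha> inj_\<beta> surj_\<alpha> surj_\<beta> by (auto simp: bij_def surj_def)
    show "(w, x) \<in> r \<longleftrightarrow> (\<beta> w, \<alpha> x) \<in> r" for w x
      using order[OF V(2) _ refl \<beta>] by blast
  qed
  then have fixed: "f (Colour x) = Colour x" "f (Cut x) = Cut x" for x using \<alpha> \<beta> by auto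
  have source: "f v \<in> Source ` carrier H \<and> w = Inr l \<longleftrightarrow> v \<in> Source ` carrier H \<and> w = Inr k"
    if v: "v \<in> vertices" "v \<notin> range Colour" "v \<notin> range Cut" for v and w :: "'a + nat"
  proof -
    have "f v \<notin> range Colour" "f v \<notin> range Cut" using colour cut v by blast+
    then show ?thesis
      using simp[of "{v, Cut w, Colour (Inr 0), Colour (Inr 1)}"] v V source_iff[of v w k]
        source_iff[of "f v" w l]
      by (simp add: image4 fixed)
  qed
  have kl: "k = l" using source[of "Source \<one>" "Inr k"] by (auto simp: vertices_def)
  have "\<exists>\<sigma>. \<forall>g \<in> carrier H. f (Source g) = Source (\<sigma> g) \<and> \<sigma> g \<in> carrier H"
    using source[of "Source _" "Inr k"] kl by (intro bchoice) (fastforce simp: vertices_def)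
  then obtain \<sigma> where \<sigma>: "\<And>g. g \<in> carrier H \<Longrightarrow> f (Source g) = Source (\<sigma> g) \<and> \<sigma> g \<in> carrier H"
    by blast
  have "\<exists>h'. f (Target h) = Target h'" if h: "h \<in> carrier H" for h
  proof -
    have T: "Target h \<in> vertices" using h by (auto simp: vertices_def)
    have "f (Target h) \<notin> range Colour" "f (Target h) \<notin> range Cut" "f (Target h) \<notin> Source ` carrier H"
      using colour[OF T] cut[OF T] source[OF T, of "Inr k"] kl by auto
    then show ?thesis using f_in[OF T] by (auto simp: vertices_def)
  qed
  then obtain \<tau> where \<tau>: "\<And>h. h \<in> carrier H \<Longrightarrow> f (Target h) = Target (\<tau> h)" by metis
  have eq: "\<tau> (g \<otimes> x) = \<sigma> g \<otimes> x" if "g \<in> carrier H" "x \<in> carrier H" for g x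
  proof -
    have "{Source g, Target (g \<otimes> x), Colour (Inl x), Cut (Inr 0)} \<in> cayley_complex k"
      using cayley_iff[OF that] by simp
    then show ?thesis
      using simp[of "{Source g, Target (g \<otimes> x), Colour (Inl x), Cut (Inr 0)}"] that \<sigma> \<tau>
        cayley_iff[of "\<sigma> g" x _ l]
      by (auto simp: image4 fixed vertices_def)
  qed
  define a where "a = \<sigma> \<one>"
  have a: "a \<in> carrier H" using \<sigma> by (simp add: a_def)
  have "\<tau> x = a \<otimes> x" if "x \<in> carrier H" for x using eq[of \<one> x] that by (simp add: a_def)
  moreover from this have "\<sigma> g = a \<otimes> g" if "g \<in> carrier H" for g
    using eq[of g \<one>] that \<sigma> by simp
  ultimately have "\<forall>v \<in> vertices. f v = translate a v"
    using \<sigma> \<tau> fixed by (auto simp: vertices_def)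
  then show ?thesis using kl a by blast
qed

end

section \<open>The automorphism groups\<close>

locale cayley_edges = coloured_cayley H r + vertex_difference \<delta>
  for H :: "('a, 'h) monoid_scheme" (structure) and r
    and \<delta> :: "('a, 'a + nat) vertex \<Rightarrow> ('a, 'a + nat) vertex \<Rightarrow> 'a + nat"
begin

definition cayley_group :: "nat \<Rightarrow> ('a + nat) partial_group" where
  "cayley_group k = edge_group (cayley_complex k)"

lemma partial_group_cayley_group: "partial_group (cayley_group k)"
  unfolding cayley_group_def
  by (rule partial_group_edge_group[OF cayley_complex_subset, where v = "Source \<one>"])
    (auto intro!: cayley_complexI simp: vertices_def)

lemma carrier_cayley_group:
  "carrier (cayley_group k) = {\<delta> a b |a b. a \<in> vertices \<and> b \<in> vertices}"
proof -
  have "{a, b} \<in> cayley_complex k \<longleftrightarrow> a \<in> vertices \<and> b \<in> vertices" for a b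
  proof
    assume "a \<in> vertices \<and> b \<in> vertices"
    then show "{a, b} \<in> cayley_complex k"
      using card_length[of "[a, b]"] by (intro cayley_complexI) auto
  qed (use cayley_complexD in blast)
  then show ?thesis unfolding cayley_group_def set_eq_iff carrier_edge_group by blast
qed

lemma diff_in_carrier: "u \<in> vertices \<Longrightarrow> v \<in> vertices \<Longrightarrow> \<delta> u v \<in> carrier (cayley_group k)"
  unfolding carrier_cayley_group by blast

lemma part_iso_cayley_group:
  assumes "\<phi> \<in> part_iso (cayley_group k) (cayley_group l)"
  shows "k = l \<and> (\<exists>a \<in> carrier H. \<forall>x \<in> carrier (cayley_group k). \<phi> x = lift (translate a) x)"
proof -
  have V: "Source \<one> \<in> vertices" "Target \<one> \<in> vertices" "Source \<one> \<noteq> Target \<one>"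
    by (auto simp: vertices_def)
  obtain f where f: "bij_betw f vertices vertices"
    "\<And>S. S \<subseteq> vertices \<Longrightarrow> f ` S \<in> cayley_complex l \<longleftrightarrow> S \<in> cayley_complex k"
    "\<And>a b. a \<in> vertices \<Longrightarrow> b \<in> vertices \<Longrightarrow> \<phi> (\<delta> a b) = \<delta> (f a) (f b)"
    by (rule iso_simplicial[OF _ _ _ _ V assms[unfolded cayley_group_def], of vertices])
      (auto intro: cayley_complexI dest: cayley_complexD)
  obtain a where a: "k = l" "a \<in> carrier H" "\<forall>v \<in> vertices. f v = translate a v"
    using complex_iso_translate[OF f(1,2)] by blast
  have "\<phi> x = lift (translate a) x" if x: "x \<in> carrier (cayley_group k)" for x
  proof -
    obtain u v where "u \<in> vertices" "v \<in> vertices" "x = \<delta> u v"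
      using x unfolding carrier_cayley_group by blast
    then show ?thesis using f(3) a(3) by simp
  qed
  with a show ?thesis by blast
qed

lemma lift_translate_mult:
  assumes "a \<in> carrier H" "b \<in> carrier H" "x \<in> carrier (cayley_group k)"
  shows "lift (translate a) (lift (translate b) x) = lift (translate (a \<otimes> b)) x"
  using assms by (auto simp: carrier_cayley_group translate_mult)

lemma lift_translate_one: "x \<in> carrier (cayley_group k) \<Longrightarrow> lift (translate \<one>) x = x"
  by (auto simp: carrier_cayley_group translate_one)

lemma lift_translate_closed:
  assumes "a \<in> carrier H" "x \<in> carrier (cayley_group k)"
  shows "lift (translate a) x \<in> carrier (cayley_group k)"
proof -
  obtain u v where "u \<in> vertices" "v \<in> vertices" "x = \<delta> u v"
    using assms(2) unfolding carrier_cayley_group by blast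
  then show ?thesis
    using translate_closed[OF assms(1)] by (simp add: diff_in_carrier)
qed

definition automorphism :: "nat \<Rightarrow> 'a \<Rightarrow> 'a + nat \<Rightarrow> 'a + nat" where
  "automorphism k a = (\<lambda>x \<in> carrier (cayley_group k). lift (translate a) x)"

lemma automorphism_in_part_Aut:
  assumes a: "a \<in> carrier H"
  shows "automorphism k a \<in> carrier (part_Aut (cayley_group k))"
proof -
  let ?M = "cayley_group k"
  interpret M: partial_group ?M by (rule partial_group_cayley_group)
  have hom: "automorphism k b \<in> part_hom ?M ?M" if "b \<in> carrier H" for b
  proof -
    have "lift (translate b) \<in> part_hom ?M ?M"
      unfolding cayley_group_def by (intro lift_part_hom translate_complex that)
    then show ?thesis
      by (rule part_hom_restrict[OF M.wdom_subset M.wprod_closed, rotated]) (simp add: automorphism_def)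
  qed
  have inverse: "automorphism k b (automorphism k c x) = x"
    if "b \<in> carrier H" "c \<in> carrier H" "b \<otimes> c = \<one>" "x \<in> carrier ?M" for b c x
    using that lift_translate_closed lift_translate_mult lift_translate_one
    by (simp add: automorphism_def)
  have iso: "automorphism k a \<in> part_iso ?M ?M"
    by (rule part_isoI[OF M.partial_monoid_axioms M.partial_monoid_axioms hom hom[of "inv a"]])
      (use a inverse in auto)
  then have "automorphism k a \<in> Bij (carrier ?M)"
    by (simp add: part_iso_def Bij_def automorphism_def)
  with iso show ?thesis by (simp add: part_Aut_def)
qed

lemma part_Aut_cayley_group: "part_Aut (cayley_group k) \<cong> H"
proof -
  let ?M = "cayley_group k" and ?A = "part_Aut (cayley_group k)"
  interpret M: partial_group ?M by (rule partial_group_cayley_group)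
  have mult: "automorphism k (a \<otimes> b) = automorphism k a \<otimes>\<^bsub>?A\<^esub> automorphism k b"
    if "a \<in> carrier H" "b \<in> carrier H" for a b
  proof -
    have "automorphism k a \<in> Bij (carrier ?M)" "automorphism k b \<in> Bij (carrier ?M)"
      using automorphism_in_part_Aut that by (auto simp: part_Aut_def)
    then have "automorphism k a \<otimes>\<^bsub>?A\<^esub> automorphism k b
        = compose (carrier ?M) (automorphism k a) (automorphism k b)"
      by (simp add: part_Aut_def BijGroup_def)
    also have "\<dots> = automorphism k (a \<otimes> b)"
      using that lift_translate_closed lift_translate_mult
      by (auto simp: automorphism_def compose_def fun_eq_iff)
    finally show ?thesis by simp
  qed
  have "inj_on (automorphism k) (carrier H)"
  proof (rule inj_onI)
    fix a b assume ab: "a \<in> carrier H" "b \<in> carrier H" "automorphism k a = automorphism k b"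
    let ?x = "\<delta> (Source \<one>) (Target \<one>)"
    have "?x \<in> carrier ?M" by (intro diff_in_carrier) (auto simp: vertices_def)
    then have "lift (translate a) ?x = lift (translate b) ?x"
      using fun_cong[OF ab(3), of ?x] by (simp add: automorphism_def)
    then show "a = b" using ab by (simp add: diff_eq_iff)
  qed
  moreover have "\<phi> \<in> automorphism k ` carrier H" if "\<phi> \<in> carrier ?A" for \<phi>
  proof -
    have \<phi>: "\<phi> \<in> part_iso ?M ?M" "\<phi> \<in> extensional (carrier ?M)"
      using that by (auto simp: part_Aut_def Bij_def)
    obtain a where a: "a \<in> carrier H" "\<forall>x \<in> carrier ?M. \<phi> x = lift (translate a) x"
      using part_iso_cayley_group[OF \<phi>(1)] by blast
    have "\<phi> = automorphism k a"
      by (rule extensionalityI[OF \<phi>(2)]) (use a(2) in \<open>simp_all add: automorphism_def\<close>)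
    with a(1) show ?thesis by blast
  qed
  ultimately have "automorphism k \<in> iso H ?A"
    using automorphism_in_part_Aut mult by (auto simp: iso_def hom_def bij_betw_def)
  then have "H \<cong> ?A" by (auto simp: is_iso_def)
  then show ?thesis by (rule iso_sym)
qed

lemma cayley_group_not_isomorphic:
  "k \<noteq> l \<Longrightarrow> \<not> part_isomorphic (cayley_group k) (cayley_group l)"
  using part_iso_cayley_group by (auto simp: part_isomorphic_def)

end

text \<open>
  Vertices are indexed by four copies of subsets of the infinite type \<open>'a + nat\<close>, so pairs of vertices
  do not exceed it in cardinality.
\<close>
lemma ex_vertex_difference:
  includes cardinal_syntax
  shows "\<exists>\<delta> :: ('a, 'a + nat) vertex \<Rightarrow> ('a, 'a + nat) vertex \<Rightarrow> 'a + nat. vertex_difference \<delta>"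
proof -
  let ?U = "UNIV :: ('a + nat) set"
  have inf: "infinite ?U" by simp
  have nat: "|UNIV :: nat set| \<le>o |?U|" using inf infinite_iff_card_of_nat by blast
  have pair: "|A \<times> B| \<le>o |?U|" if "|A| \<le>o |?U|" "|B| \<le>o |?U|" for A :: "'x set" and B :: "'y set"
    using inf by (intro card_of_Times_ordLeq_infinite_Field that card_of_Card_order)
      (simp add: Field_card_of)
  define code :: "('a, 'a + nat) vertex \<Rightarrow> nat \<times> ('a + nat)" where
    "code v = (case v of Source g \<Rightarrow> (0, Inl g) | Target g \<Rightarrow> (1, Inl g) | Colour x \<Rightarrow> (2, x)
      | Cut x \<Rightarrow> (3, x))" for v
  have "inj code" by (auto simp: inj_def code_def split: vertex.splits)
  then have "|UNIV :: ('a, 'a + nat) vertex set| \<le>o |UNIV :: (nat \<times> ('a + nat)) set|"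
    using card_of_ordLeq by blast
  moreover have "|UNIV :: (nat \<times> ('a + nat)) set| \<le>o |?U|"
    using pair[OF nat ordLeq_refl[OF card_of_Card_order]] by simp
  ultimately have vert: "|UNIV :: ('a, 'a + nat) vertex set| \<le>o |?U|"
    by (rule ordLeq_transitive)
  let ?VV = "UNIV :: (nat \<times> ('a, 'a + nat) vertex \<times> ('a, 'a + nat) vertex) set"
  have "|?VV| \<le>o |?U|"
    using pair[OF nat pair[OF vert vert]] by simp
  then obtain \<iota> :: "nat \<times> ('a, 'a + nat) vertex \<times> ('a, 'a + nat) vertex \<Rightarrow> 'a + nat" where "inj \<iota>"
    using card_of_ordLeq[of ?VV ?U] by auto
  then have "vertex_difference (\<lambda>a b. \<iota> (if a = b then (0, undefined) else (1, a, b)))"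
    by unfold_locales (auto simp: inj_eq)
  then show ?thesis by blast
qed

text \<open>A wellorder of least possible order type on an infinite set is a limit.\<close>
lemma ex_wellorder_without_top:
  includes cardinal_syntax
  assumes "infinite (UNIV :: 'w set)"
  shows "\<exists>r :: 'w rel. well_order_on UNIV r \<and> (\<forall>x. \<exists>y. y \<noteq> x \<and> (x, y) \<in> r)"
proof (rule exI[of _ "|UNIV :: 'w set|"], intro conjI allI)
  show "well_order_on UNIV |UNIV :: 'w set|" by (rule card_of_well_order_on)
  show "\<exists>y. y \<noteq> x \<and> (x, y) \<in> |UNIV :: 'w set|" for x
    using infinite_Card_order_limit[OF card_of_Card_order, of UNIV x] assms
    by (auto simp: Field_card_of)
qed

theorem theorem1:
  fixes H :: "('a, 'h) monoid_scheme"
  assumes "group H"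
  shows "(\<exists>M :: ('a + nat) partial_group. partial_group M \<and> part_Aut M \<cong> H) \<and>
    (\<exists>S :: ('a + nat) partial_group set.
      infinite S \<and>
      (\<forall>M\<in>S. partial_group M \<and> part_Aut M \<cong> H) \<and>
      (\<forall>M\<in>S. \<forall>N\<in>S. M \<noteq> N \<longrightarrow> \<not> part_isomorphic M N))"
proof -
  obtain r :: "('a + nat) rel" where r: "well_order_on UNIV r" "\<And>x. \<exists>y. y \<noteq> x \<and> (x, y) \<in> r"
    using ex_wellorder_without_top[where 'w = "'a + nat"] by auto
  obtain \<delta> :: "('a, 'a + nat) vertex \<Rightarrow> ('a, 'a + nat) vertex \<Rightarrow> 'a + nat"
    where \<delta>: "vertex_difference \<delta>" using ex_vertex_difference by blast
  interpret cayley_edges H r \<delta>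
    by (intro cayley_edges.intro coloured_cayley.intro coloured_cayley_axioms.intro assms r \<delta>)
  have refl: "part_isomorphic (cayley_group k) (cayley_group k)" for k
    using automorphism_in_part_Aut[OF one_closed, of k]
    by (auto simp: part_isomorphic_def part_Aut_def)
  have "inj cayley_group"
    using refl cayley_group_not_isomorphic by (metis injI)
  then have "infinite (range cayley_group)" by (simp add: finite_image_iff)
  moreover have "\<not> part_isomorphic M N"
    if MN: "M \<in> range cayley_group" "N \<in> range cayley_group" "M \<noteq> N" for M N
  proof -
    obtain k l where "M = cayley_group k" "N = cayley_group l" using MN(1,2) by blast
    then show ?thesis using MN(3) cayley_group_not_isomorphic[of k l] by auto
  qed
  moreover have "\<forall>M \<in> range cayley_group. partial_group M \<and> part_Aut M \<cong> H"
    using partial_group_cayley_group part_Aut_cayley_group by simp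
  ultimately show ?thesis
    by (intro conjI exI[of _ "cayley_group 0"] exI[of _ "range cayley_group"]) simp_all
qed

end
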